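(* Let $p_1\ge p_2\ge\cdots>0$ with $\sum_{j=1}^\infty p_j<\infty$. For $x>0$ let $\Delta\nu(x):=\#\{j:\ x/2<p_j\le x\}$ and $D(x):=\int_0^x\Delta\nu(u)\,du$, and for $t\ge0$ let $V(t):=\sum_{j=1}^\infty(e^{-tp_j}-e^{-2tp_j})$. Let $v$ be a (finite) real number. Then the condition $$\lim_{x\downarrow0}\ x\int_x^\infty\Delta\nu(u)\,u^{-2}\,du=v$$ is equivalent to $$\lim_{x\downarrow0}\frac{D(x)}{x}=v,$$ and hence the former condition is necessary and sufficient in order that $V(t)\to v$ as $t\to\infty$.
   Context: $V(t)$ is the variance of the number of occupied boxes at time $t$ in the poissonized occupancy scheme, in which box $j$ receives balls according to a Poisson process of rate $p_j$, independently over $j$. The integral defining $D(x)$ is finite for all $x$. *)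

theory Defs
  imports "HOL-Analysis.Analysis"
begin

text \<open>
  Throughout, \<open>p j\<close> (with \<open>j\<close> starting at \<open>0\<close>) is the rate of the Poisson process feeding
  the \<open>(j+1)\<close>-st box.
\<close>

definition Delta_nu :: "(nat \<Rightarrow> real) \<Rightarrow> real \<Rightarrow> nat" where
  "Delta_nu p x = card {j. x / 2 < p j \<and> p j \<le> x}"

definition D_int :: "(nat \<Rightarrow> real) \<Rightarrow> real \<Rightarrow> real" where
  "D_int p x = (LINT u:{0<..x}|lborel. real (Delta_nu p u))"

text \<open>
  The variance of the number of occupied boxes at time \<open>t\<close>: box \<open>j\<close> is occupied with
  probability \<open>1 - exp (- t * p j)\<close>, independently over \<open>j\<close>.
\<close>

definition V_occ :: "(nat \<Rightarrow> real) \<Rightarrow> real \<Rightarrow> real" where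
  "V_occ p t = (\<Sum>j. exp (- t * p j) - exp (- 2 * t * p j))"

text \<open>
  For positive summable rates the cardinality, the integrals and the series are all genuine
  (none of them takes its default value).
\<close>

lemma finite_Delta_nu:
  fixes p :: "nat \<Rightarrow> real"
  assumes "summable p" "\<And>j. 0 < p j"
  shows "finite {j. x / 2 < p j \<and> p j \<le> x}"
proof (cases "x > 0")
  case True
  have "p \<longlonglongrightarrow> 0" using assms(1) by (rule summable_LIMSEQ_zero)
  then have "eventually (\<lambda>j. p j < x / 2) sequentially"
    using True by (intro order_tendstoD) auto
  then obtain N where "\<And>j. j \<ge> N \<Longrightarrow> p j < x / 2"
    by (auto simp: eventually_sequentially)
  then have "{j. x / 2 < p j \<and> p j \<le> x} \<subseteq> {..<N}"
    by (force simp: not_le[symmetric])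
  then show ?thesis using finite_subset by blast
next
  case False
  have "\<not> p j \<le> x" for j using assms(2)[of j] False by linarith
  then show ?thesis by simp
qed

lemma sums_Delta_nu:
  fixes p :: "nat \<Rightarrow> real"
  assumes "summable p" "\<And>j. 0 < p j"
  shows "(\<lambda>j. indicator {p j..<2 * p j} x :: real) sums real (Delta_nu p x)"
proof -
  let ?A = "{j. x / 2 < p j \<and> p j \<le> x}"
  have "(\<lambda>j. if j \<in> ?A then 1 else 0 :: real) sums (\<Sum>j\<in>?A. 1)"
    using finite_Delta_nu[OF assms] by (rule sums_If_finite_set)
  moreover have "(\<lambda>j. if j \<in> ?A then 1 else 0 :: real) = (\<lambda>j. indicator {p j..<2 * p j} x)"
    by (auto simp: indicator_def fun_eq_iff)
  ultimately show ?thesis by (simp add: Delta_nu_def)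
qed

lemma integrable_Delta_nu:
  fixes p :: "nat \<Rightarrow> real"
  assumes "summable p" "\<And>j. 0 < p j"
  shows "integrable lborel (\<lambda>x. real (Delta_nu p x))"
proof -
  have pos: "0 \<le> p j" for j using assms(2)[of j] by simp
  have meas: "measure lborel {p j..<2 * p j} = p j" for j
    using pos[of j] by simp
  have "integrable lborel (\<lambda>x. \<Sum>j. indicator {p j..<2 * p j} x :: real)"
  proof (rule integrable_suminf)
    show "integrable lborel (\<lambda>x. indicator {p j..<2 * p j} x :: real)" for j
      by (intro integrable_real_indicator) (auto simp: pos)
    show "AE x in lborel. summable (\<lambda>j. norm (indicator {p j..<2 * p j} x :: real))"
      using sums_Delta_nu[OF assms] by (auto simp: sums_iff)
    show "summable (\<lambda>j. LINT x|lborel. norm (indicator {p j..<2 * p j} x :: real))"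
      using assms(1) meas by simp
  qed
  then show ?thesis
    using sums_Delta_nu[OF assms] by (simp add: sums_iff)
qed

lemma set_integrable_D_int:
  fixes p :: "nat \<Rightarrow> real"
  assumes "summable p" "\<And>j. 0 < p j"
  shows "set_integrable lborel {0<..x} (\<lambda>u. real (Delta_nu p u))"
  unfolding set_integrable_def
  using integrable_mult_indicator[OF _ integrable_Delta_nu[OF assms]] by simp

lemma set_integrable_Delta_nu_tail:
  fixes p :: "nat \<Rightarrow> real"
  assumes "summable p" "\<And>j. 0 < p j" "0 < x"
  shows "set_integrable lborel {x..} (\<lambda>u. real (Delta_nu p u) / u\<^sup>2)"
  unfolding set_integrable_def
proof (rule Bochner_Integration.integrable_bound)
  show "integrable lborel (\<lambda>u. real (Delta_nu p u) / x\<^sup>2)"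
    using integrable_Delta_nu[OF assms(1,2)] by simp
  have "(\<lambda>u. real (Delta_nu p u)) \<in> borel_measurable lborel"
    using integrable_Delta_nu[OF assms(1,2)] by auto
  then show "(\<lambda>u. indicator {x..} u *\<^sub>R (real (Delta_nu p u) / u\<^sup>2)) \<in> borel_measurable lborel"
    by measurable
  show "AE u in lborel. norm (indicator {x..} u *\<^sub>R (real (Delta_nu p u) / u\<^sup>2))
      \<le> norm (real (Delta_nu p u) / x\<^sup>2)"
    using assms(3) by (auto simp: indicator_def intro!: AE_I2 divide_left_mono power_mono)
qed

lemma summable_V_occ:
  fixes p :: "nat \<Rightarrow> real"
  assumes "summable p" "\<And>j. 0 < p j" "0 \<le> t"
  shows "summable (\<lambda>j. exp (- t * p j) - exp (- 2 * t * p j))"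
proof (rule summable_comparison_test')
  show "summable (\<lambda>j. t * p j)" using assms(1) by (rule summable_mult)
  fix j :: nat
  define a where "a = t * p j"
  have a: "0 \<le> a" using assms(2)[of j] assms(3) by (simp add: a_def)
  have "exp (- a) - exp (- 2 * a) = exp (- a) * (1 - exp (- a))"
    by (simp add: algebra_simps flip: exp_add)
  moreover have "\<dots> \<le> 1 * a"
    using a exp_ge_add_one_self[of "- a"] by (intro mult_mono) auto
  moreover have "0 \<le> exp (- a) * (1 - exp (- a))" using a by simp
  ultimately show "norm (exp (- t * p j) - exp (- 2 * t * p j)) \<le> t * p j"
    by (simp add: a_def mult.assoc)
qed

end

theory Submission
  imports Defs "HOL-Real_Asymp.Real_Asymp"
begin

text \<open>
  Write \<open>g = \<Delta>\<nu>\<close>, \<open>D(x) = \<integral>\<^sub>0\<^sup>x g\<close> and \<open>F(x) = \<integral>\<^sub>x\<^sup>\<infinity> g(s) s\<^sup>-\<^sup>2 ds\<close>.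
  By Fubini, the quantity \<open>S(x) = D(x)/x + x F(x) = x\<^sup>-\<^sup>1 \<integral> g(s) min(1, x\<^sup>2/s\<^sup>2) ds\<close> is
  an average of \<open>u \<mapsto> D(u)/u\<close> over \<open>u = x y\<close> with weight \<open>2 y\<^sup>-\<^sup>2\<close> on \<open>[1, \<infinity>)\<close>, and also an
  average of \<open>u \<mapsto> u F(u)\<close> with weight \<open>2\<close> on \<open>(0, 1]\<close>. Hence, by dominated convergence, if
  either \<open>D(x)/x\<close> or \<open>x F(x)\<close> tends to \<open>v\<close>, then \<open>S(x)\<close> tends to \<open>2 v\<close>, and so the other one
  tends to \<open>v\<close> too.

  Since \<open>exp(- t p) - exp(- 2 t p) = t \<integral> exp(- t u) 1[p \<le> u < 2 p] du\<close>, we have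
  \<open>V(t) = t \<integral> exp(- t u) g(u) du\<close>. This is an average of \<open>D(u)/u\<close> over \<open>u = y/t\<close> with weight
  \<open>y exp(- y)\<close>, which gives the Abelian direction. The converse is Karamata's argument: the
  limit of \<open>V\<close> determines the limit of \<open>t \<integral> exp(- t u) q(exp(- t u)) g(u) du\<close> for monomials \<open>q\<close>,
  hence for polynomials, hence (Weierstrass) for continuous \<open>q\<close>; and \<open>t D(1/t)\<close> is the case
  \<open>q(y) = 1/y\<close> for \<open>y \<ge> 1/e\<close> and \<open>0\<close> otherwise, which continuous functions bracket.
\<close>

section \<open>Improper integrals and averages of functions with a limit at 0\<close>

lemma has_bochner_integral_FTC_atLeast:
  fixes f F :: "real \<Rightarrow> real"
  assumes [measurable]: "f \<in> borel_measurable borel"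
    and deriv: "\<And>x. a \<le> x \<Longrightarrow> (F has_real_derivative f x) (at x)"
    and nonneg: "\<And>x. a \<le> x \<Longrightarrow> 0 \<le> f x"
    and lim: "(F \<longlongrightarrow> T) at_top"
  shows "has_bochner_integral lborel (\<lambda>x. if a \<le> x then f x else 0) (T - F a)"
proof (rule has_bochner_integral_nn_integral)
  have "F a \<le> F x" if "a \<le> x" for x
    using that deriv nonneg by (intro DERIV_nonneg_imp_nondecreasing[of a x F]) auto
  then have "F a \<le> T"
    by (intro tendsto_lowerbound[OF lim] eventually_mono[OF eventually_ge_at_top[of a]]) auto
  then show "0 \<le> T - F a" by simp
  have "(\<integral>\<^sup>+x. ennreal (if a \<le> x then f x else 0) \<partial>lborel)
      = (\<integral>\<^sup>+x. ennreal (f x) * indicator {a..} x \<partial>lborel)"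
    by (intro nn_integral_cong) auto
  also have "\<dots> = T - F a"
    using assms by (intro nn_integral_FTC_atLeast) auto
  finally show "(\<integral>\<^sup>+x. ennreal (if a \<le> x then f x else 0) \<partial>lborel) = ennreal (T - F a)" .
qed (use nonneg in auto)

text \<open>Near 0 the limit bounds \<open>f\<close>, and away from 0 the decay \<open>M / u\<close>
  does. The resulting global bound supplies the dominating function for the averaging lemma
  below.\<close>

lemma bounded_of_limit_and_decay:
  fixes f :: "real \<Rightarrow> real"
  assumes nonneg: "\<And>u. 0 < u \<Longrightarrow> 0 \<le> f u"
    and decay: "\<And>u. 0 < u \<Longrightarrow> f u \<le> M / u"
    and lim: "(f \<longlongrightarrow> v) (at_right 0)"
  obtains C where "0 \<le> C" "\<And>u. 0 < u \<Longrightarrow> f u \<le> C"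
proof -
  have "eventually (\<lambda>u. f u < v + 1) (at_right 0)"
    using lim by (rule order_tendstoD) simp
  then obtain d where d: "0 < d" "\<And>u. 0 < u \<Longrightarrow> u < d \<Longrightarrow> f u < v + 1"
    by (auto simp: eventually_at_right_field)
  have M: "0 \<le> M" using nonneg[of 1] decay[of 1] by simp
  have "f u \<le> max (v + 1) (M / d)" if "0 < u" for u
  proof (cases "u < d")
    case True
    then show ?thesis using d(2)[OF that] by simp
  next
    case False
    then have "M / u \<le> M / d" using d(1) M by (intro divide_left_mono) auto
    then show ?thesis using decay[OF that] by simp
  qed
  moreover from this[of 1] have "0 \<le> max (v + 1) (M / d)" using nonneg[of 1] by linarith
  ultimately show ?thesis by (rule that[rotated])
qed

text \<open>For fixed \<open>y > 0\<close> the argument \<open>x * y\<close> tends to 0 with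
  \<open>x\<close>, so the integrand tends to \<open>w y * v\<close>; a global bound
  \<open>C\<close> on \<open>f\<close> gives the integrable majorant
  \<open>\<bar>w y\<bar> * C\<close>. The limit is \<open>v\<close> times the total mass of the
  weight.\<close>

lemma abelian_averaging:
  fixes f w :: "real \<Rightarrow> real"
  assumes [measurable]: "f \<in> borel_measurable borel"
    and nonneg: "\<And>u. 0 < u \<Longrightarrow> 0 \<le> f u"
    and decay: "\<And>u. 0 < u \<Longrightarrow> f u \<le> M / u"
    and lim: "(f \<longlongrightarrow> v) (at_right 0)"
    and w: "has_bochner_integral lborel w I"
    and w_zero: "\<And>y. y \<le> 0 \<Longrightarrow> w y = 0"
  shows "((\<lambda>x. LINT y|lborel. w y * f (x * y)) \<longlongrightarrow> I * v) (at_right 0)"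
proof -
  have w_int: "integrable lborel w" and w_val: "integral\<^sup>L lborel w = I"
    using w by (auto simp: has_bochner_integral_iff)
  have [measurable]: "w \<in> borel_measurable borel" using w_int by auto
  obtain C where C: "0 \<le> C" "\<And>u. 0 < u \<Longrightarrow> f u \<le> C"
    using bounded_of_limit_and_decay[OF nonneg decay lim] by blast
  \<comment> \<open>Substitute \<open>x = inverse t\<close>, because dominated convergence is
    applied along \<open>at_top\<close>.\<close>
  have "((\<lambda>t. LINT y|lborel. w y * f (inverse t * y)) \<longlongrightarrow> (LINT y|lborel. w y * v)) at_top"
  proof (rule integral_dominated_convergence_at_top[where w = "\<lambda>y. \<bar>w y\<bar> * C"])
    show "integrable lborel (\<lambda>y. \<bar>w y\<bar> * C)" using w_int by auto
    show "\<forall>\<^sub>F t in at_top. AE y in lborel. norm (w y * f (inverse t * y)) \<le> \<bar>w y\<bar> * C"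
      using eventually_gt_at_top[of 0]
    proof eventually_elim
      case (elim t)
      have "norm (w y * f (inverse t * y)) \<le> \<bar>w y\<bar> * C" for y
      proof (cases "0 < y")
        case True
        then have "0 < inverse t * y" using elim by simp
        then show ?thesis
          using C(2) nonneg by (auto simp: abs_mult intro!: mult_left_mono)
      qed (simp add: w_zero)
      then show ?case by simp
    qed
    show "AE y in lborel. ((\<lambda>t. w y * f (inverse t * y)) \<longlongrightarrow> w y * v) at_top"
    proof (rule AE_I2)
      fix y :: real
      show "((\<lambda>t. w y * f (inverse t * y)) \<longlongrightarrow> w y * v) at_top"
      proof (cases "0 < y")
        case True
        then have "filterlim (\<lambda>t. inverse t * y) (at_right 0) at_top" by real_asymp
        from filterlim_compose[OF lim this] show ?thesis by (intro tendsto_intros)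
      qed (simp add: w_zero)
    qed
  qed auto
  then show ?thesis by (simp add: filterlim_at_right_to_top w_val)
qed

section \<open>Masses and means of a function\<close>

definition head_mass :: "(real \<Rightarrow> real) \<Rightarrow> real \<Rightarrow> real" where
  "head_mass g x = (LINT s:{0<..x}|lborel. g s)"

definition tail_mass :: "(real \<Rightarrow> real) \<Rightarrow> real \<Rightarrow> real" where
  "tail_mass g x = (LINT s:{x..}|lborel. g s / s\<^sup>2)"

text \<open>The factor \<open>t\<close> makes \<open>t * exp (- t * s)\<close> a probability density
  on the positive half-line, so this is a genuine average of \<open>g\<close> there.\<close>

definition laplace_mean :: "(real \<Rightarrow> real) \<Rightarrow> real \<Rightarrow> real" where
  "laplace_mean g t = t * (LINT s|lborel. g s * exp (- t * s))"

text \<open>With \<open>y = exp (- t * s)\<close> one has \<open>dy = - t * y ds\<close>, so for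
  \<open>g = 1\<close> on the positive half-line this is the integral of \<open>q\<close> over
  [0, 1]. That explains the limits \<open>v * integral {0..1} q\<close> below.\<close>

definition weighted_mean :: "(real \<Rightarrow> real) \<Rightarrow> (real \<Rightarrow> real) \<Rightarrow> real \<Rightarrow> real" where
  "weighted_mean g q t = t * (LINT s|lborel. g s * (exp (- t * s) * q (exp (- t * s))))"

section \<open>Continuous approximation of the reciprocal cut off at
  \<open>exp (- 1)\<close>\<close>

definition ramp :: "real \<Rightarrow> real" where
  "ramp y = max 0 (min 1 y)"

lemma ramp_simps: "y \<le> 0 \<Longrightarrow> ramp y = 0" "1 \<le> y \<Longrightarrow> ramp y = 1" "0 \<le> ramp y" "ramp y \<le> 1"
  by (auto simp: ramp_def)

text \<open>The ramp rises from 0 at \<open>b\<close> to 1 at \<open>b + d\<close>, smoothing the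
  jump of the cutoff; \<open>max c y\<close> replaces \<open>y\<close> to keep the denominator at
  least \<open>c > 0\<close> on the whole line.\<close>

lemma continuous_ramp_quotient:
  assumes "0 < c" "0 < d"
  shows "continuous_on UNIV (\<lambda>y. ramp ((y - b) / d) / max c y)"
  unfolding ramp_def using assms by (intro continuous_intros) (auto simp: max_def)

text \<open>This value 1 is what turns the Karamata limit for the cut reciprocal into exactly
  \<open>v\<close>.\<close>

lemma has_integral_cut_reciprocal:
  "((\<lambda>y. if exp (- 1) \<le> y then 1 / y else 0) has_integral (1::real)) {0..1}"
proof -
  have "((\<lambda>y::real. 1 / y) has_integral ln 1 - ln (exp (- 1))) {exp (- 1)..1}"
  proof (rule fundamental_theorem_of_calculus)
    fix y :: real assume "y \<in> {exp (- 1)..1}"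
    moreover have "0 < exp (- 1 :: real)" by simp
    ultimately have "0 < y" by (meson atLeastAtMost_iff less_le_trans)
    then show "(ln has_vector_derivative 1 / y) (at y within {exp (- 1)..1})"
      unfolding has_real_derivative_iff_has_vector_derivative[symmetric]
      by (auto intro!: derivative_eq_intros)
  qed simp
  then have "((\<lambda>y::real. if y \<in> {exp (- 1)..1} then 1 / y else 0) has_integral 1) {0..1}"
    by (subst has_integral_restrict) auto
  then show ?thesis
    by (rule has_integral_eq[rotated]) auto
qed

lemma has_integral_bump:
  assumes "0 \<le> a" "a \<le> b" "b \<le> (1::real)"
  shows "((\<lambda>y. if y \<in> {a..b} then C else 0) has_integral C * (b - a)) {0..1}"
  using assms has_integral_const_real[of C a b]
  by (subst has_integral_restrict) (auto simp: mult.commute)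

text \<open>On [0, 1] each ramp quotient agrees with the cut reciprocal except on an interval of
  length \<open>d\<close> next to \<open>exp (- 1)\<close>, where the two differ by at most
  \<open>1 / exp (- 1)\<close>. The conditions on \<open>d\<close> keep that interval inside
  [0, 1].\<close>

lemma integral_ramp_quotient:
  assumes d: "0 < d" "d \<le> exp (- 1)" "exp (- 1) + d \<le> 1"
  shows "1 - d / exp (- 1) \<le> integral {0..1} (\<lambda>y. ramp ((y - exp (- 1)) / d) / max (exp (- 1)) y)" (is ?low)
    and "integral {0..1} (\<lambda>y. ramp ((y - (exp (- 1) - d)) / d) / max (exp (- 1)) y) \<le> 1 + d / exp (- 1)" (is ?up)
proof -
  define c :: real where "c = exp (- 1)"
  have c: "0 < c" by (simp add: c_def)
  have int: "(\<lambda>y. ramp ((y - b) / d) / max c y) integrable_on {0..1}" for b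
    using continuous_on_subset[OF continuous_ramp_quotient[OF c d(1)]]
    by (intro integrable_continuous_real) auto
  note cut = has_integral_cut_reciprocal[folded c_def]
  \<comment> \<open>Subtracting \<open>1 / c\<close> where the ramp rises makes the minorant
    nonpositive there, since \<open>1 / y \<le> 1 / c\<close>.\<close>
  have "((\<lambda>y. (if c \<le> y then 1 / y else 0) - (if y \<in> {c..c + d} then 1 / c else 0))
      has_integral 1 - 1 / c * (c + d - c)) {0..1}"
    using d c unfolding c_def[symmetric]
    by (intro has_integral_diff cut has_integral_bump) auto
  then have "1 - 1 / c * (c + d - c) \<le> integral {0..1} (\<lambda>y. ramp ((y - c) / d) / max c y)"
  proof (rule has_integral_le[OF _ integrable_integral[OF int]])
    fix y :: real assume "y \<in> {0..1}"
    consider "y < c" | "c \<le> y" "y \<le> c + d" | "c + d < y" by linarith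
    then show "(if c \<le> y then 1 / y else 0) - (if y \<in> {c..c + d} then 1 / c else 0)
        \<le> ramp ((y - c) / d) / max c y"
    proof cases
      case 2
      then have "1 / y \<le> 1 / c" using c by (intro divide_left_mono) auto
      moreover have "0 \<le> ramp ((y - c) / d) / max c y" using c 2 by (simp add: ramp_simps)
      ultimately show ?thesis using 2 by simp
    qed (use c d in \<open>auto simp: ramp_simps max_def\<close>)
  qed
  then show ?low by (simp add: c_def)
  have "((\<lambda>y. (if c \<le> y then 1 / y else 0) + (if y \<in> {c - d..c} then 1 / c else 0))
      has_integral 1 + 1 / c * (c - (c - d))) {0..1}"
    using d c unfolding c_def[symmetric]
    by (intro has_integral_add cut has_integral_bump) auto
  then have "integral {0..1} (\<lambda>y. ramp ((y - (c - d)) / d) / max c y) \<le> 1 + 1 / c * (c - (c - d))"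
  proof (rule has_integral_le[OF integrable_integral[OF int]])
    fix y :: real assume "y \<in> {0..1}"
    consider "y < c - d" | "c - d \<le> y" "y < c" | "c \<le> y" by linarith
    then show "ramp ((y - (c - d)) / d) / max c y
        \<le> (if c \<le> y then 1 / y else 0) + (if y \<in> {c - d..c} then 1 / c else 0)"
    proof cases
      case 1
      then show ?thesis using d c by (simp add: ramp_simps divide_nonpos_pos)
    next
      case 2
      then show ?thesis using c by (simp add: ramp_simps divide_right_mono)
    next
      case 3
      then show ?thesis using c by (auto simp: ramp_simps divide_right_mono)
    qed
  qed
  then show ?up by (simp add: c_def)
qed

lemma inverse_square_bound:
  "0 < x \<Longrightarrow> \<bar>if x \<le> s then 1 / s\<^sup>2 else 0\<bar> \<le> 1 / (x::real)\<^sup>2"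
  by (auto intro!: divide_left_mono power_mono)

section \<open>Fubini identities for an integrable nonnegative \<open>g\<close> on the positive
  half-line\<close>

context
  fixes g :: "real \<Rightarrow> real"
  assumes g_int: "integrable lborel g"
    and g_nonneg: "\<And>s. 0 \<le> g s"
    and g_zero: "\<And>s. s \<le> 0 \<Longrightarrow> g s = 0"
begin

lemma g_borel [measurable]: "g \<in> borel_measurable borel"
  using g_int by auto

lemma integrable_mult_g:
  assumes [measurable]: "h \<in> borel_measurable borel"
    and bound: "\<And>s. 0 < s \<Longrightarrow> \<bar>h s\<bar> \<le> C"
  shows "integrable lborel (\<lambda>s. g s * h s)"
proof (rule Bochner_Integration.integrable_bound)
  show "integrable lborel (\<lambda>s. g s * C)" using g_int by simp
  have "norm (g s * h s) \<le> norm (g s * C)" for s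
  proof (cases "0 < s")
    case True
    then have "\<bar>h s\<bar> \<le> \<bar>C\<bar>" using bound[OF True] by linarith
    then show ?thesis by (auto simp: abs_mult intro!: mult_left_mono)
  qed (simp add: g_zero)
  then show "AE s in lborel. norm (g s * h s) \<le> norm (g s * C)" by simp
qed simp

text \<open>Fubini: by nonnegativity the norms integrate over \<open>y\<close> to
  \<open>g s * K s\<close>, which is integrable because \<open>K\<close> is bounded for positive
  \<open>s\<close>. Later identities arise by computing both iterated integrals of a suitable
  kernel.\<close>

lemma integral_kernel_swap:
  fixes k :: "real \<Rightarrow> real \<Rightarrow> real"
  assumes k_meas [measurable]: "case_prod k \<in> borel_measurable (borel \<Otimes>\<^sub>M borel)"
    and k_nonneg: "\<And>s y. 0 < s \<Longrightarrow> 0 \<le> k s y"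
    and k_int: "\<And>s. 0 < s \<Longrightarrow> has_bochner_integral lborel (k s) (K s)"
    and K_meas [measurable]: "K \<in> borel_measurable borel"
    and K_bound: "\<And>s. 0 < s \<Longrightarrow> K s \<le> C"
  shows "(LINT y|lborel. LINT s|lborel. g s * k s y) = (LINT s|lborel. g s * K s)"
proof -
  have K_nonneg: "0 \<le> K s" if "0 < s" for s
    using k_int[OF that] k_nonneg[OF that] integral_nonneg_AE[of "k s" lborel]
    by (auto simp: has_bochner_integral_iff)
  \<comment> \<open>For \<open>s \<le> 0\<close> both sides vanish with \<open>g s\<close>, so the
    kernel needs control only for positive \<open>s\<close>.\<close>
  have inner: "(LINT y|lborel. g s * k s y) = g s * K s" for s
    using k_int[of s] g_zero[of s] by (cases "0 < s") (auto simp: has_bochner_integral_iff)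
  have inner_norm: "(LINT y|lborel. norm (g s * k s y)) = g s * K s" for s
  proof (cases "0 < s")
    case True
    then show ?thesis using inner[of s] k_nonneg g_nonneg by (simp add: abs_mult)
  qed (simp add: g_zero)
  have "integrable (lborel \<Otimes>\<^sub>M lborel) (\<lambda>(s, y). g s * k s y)"
  proof (rule lborel_pair.Fubini_integrable)
    show "(\<lambda>(s, y). g s * k s y) \<in> borel_measurable (lborel \<Otimes>\<^sub>M lborel)"
      by measurable
    show "integrable lborel (\<lambda>s. LINT y|lborel. norm (case (s, y) of (s, y) \<Rightarrow> g s * k s y))"
      using integrable_mult_g[OF K_meas, of C] K_bound K_nonneg
      by (simp add: inner_norm del: real_norm_def)
    have "integrable lborel (\<lambda>y. g s * k s y)" for s
      using k_int[of s] g_zero[of s] by (cases "0 < s") (auto simp: has_bochner_integral_iff)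
    then show "AE s in lborel. integrable lborel (\<lambda>y. case (s, y) of (s, y) \<Rightarrow> g s * k s y)"
      by simp
  qed
  from lborel_pair.Fubini_integral[OF this] show ?thesis by (simp only: inner)
qed

lemma head_mass_alt: "head_mass g x = (LINT s|lborel. g s * (if s \<le> x then 1 else 0))"
  unfolding head_mass_def set_lebesgue_integral_def
  by (intro Bochner_Integration.integral_cong) (auto simp: indicator_def g_zero)

lemma tail_mass_alt:
  assumes "0 < x"
  shows "tail_mass g x = (LINT s|lborel. g s * (if x \<le> s then 1 / s\<^sup>2 else 0))"
  unfolding tail_mass_def set_lebesgue_integral_def
  by (intro Bochner_Integration.integral_cong) (auto simp: indicator_def)

lemma head_mass_borel [measurable]: "head_mass g \<in> borel_measurable borel"
  unfolding head_mass_alt by measurable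

lemma head_mass_0: "head_mass g 0 = 0"
  by (simp add: head_mass_def set_lebesgue_integral_def)

lemma head_mass_nonneg: "0 \<le> head_mass g x"
  unfolding head_mass_alt by (intro integral_nonneg_AE) (auto simp: g_nonneg)

lemma integrable_head: "integrable lborel (\<lambda>s. g s * (if s \<le> x then 1 else 0))"
  by (rule integrable_mult_g[of _ 1]) auto

lemma head_mass_le: "head_mass g x \<le> integral\<^sup>L lborel g"
  unfolding head_mass_alt
  by (intro integral_mono integrable_head g_int) (auto simp: g_nonneg)

lemma tail_mass_borel [measurable]: "tail_mass g \<in> borel_measurable borel"
proof -
  have "tail_mass g = (\<lambda>x. LINT s|lborel. (if x \<le> s then g s / s\<^sup>2 else 0))"
    unfolding tail_mass_def set_lebesgue_integral_def
    by (intro ext Bochner_Integration.integral_cong) (auto simp: indicator_def)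
  then show ?thesis by simp
qed

lemma tail_mass_nonneg: "0 \<le> tail_mass g x"
  unfolding tail_mass_def set_lebesgue_integral_def
  by (intro integral_nonneg_AE) (auto simp: g_nonneg)

lemma integrable_tail:
  assumes "0 < x"
  shows "integrable lborel (\<lambda>s. g s * (if x \<le> s then 1 / s\<^sup>2 else 0))"
proof (rule integrable_mult_g)
  show "\<bar>if x \<le> s then 1 / s\<^sup>2 else 0\<bar> \<le> 1 / x\<^sup>2" for s
    by (rule inverse_square_bound[OF assms])
qed measurable

lemma tail_mass_le:
  assumes "0 < x"
  shows "tail_mass g x \<le> integral\<^sup>L lborel g / x\<^sup>2"
proof -
  have "tail_mass g x \<le> (LINT s|lborel. g s * (1 / x\<^sup>2))"
    unfolding tail_mass_alt[OF assms]
  proof (intro integral_mono integrable_tail assms)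
    show "g s * (if x \<le> s then 1 / s\<^sup>2 else 0) \<le> g s * (1 / x\<^sup>2)" for s
      using inverse_square_bound[OF assms, of s] g_nonneg[of s] by (intro mult_left_mono) auto
  qed (use g_int in auto)
  then show ?thesis by simp
qed

lemma integral_clamped:
  assumes x: "0 < x"
  shows "(LINT s|lborel. g s * (if s \<le> x then 1 else x\<^sup>2 / s\<^sup>2)) = head_mass g x + x\<^sup>2 * tail_mass g x"
proof -
  let ?a = "\<lambda>s. g s * (if s \<le> x then 1 else 0)"
    and ?b = "\<lambda>s. g s * (if x \<le> s then 1 / s\<^sup>2 else 0)"
  have int: "integrable lborel ?a" "integrable lborel ?b"
    using integrable_head integrable_tail[OF x] by auto
  have "(LINT s|lborel. g s * (if s \<le> x then 1 else x\<^sup>2 / s\<^sup>2)) = (LINT s|lborel. ?a s + x\<^sup>2 * ?b s)"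
  proof (rule integral_cong_AE)
    \<comment> \<open>The point \<open>s = x\<close> belongs to both the head and the tail, so the
      splitting holds only almost everywhere.\<close>
    show "AE s in lborel. g s * (if s \<le> x then 1 else x\<^sup>2 / s\<^sup>2) = ?a s + x\<^sup>2 * ?b s"
      using AE_lborel_singleton[of x] by eventually_elim auto
  qed auto
  also have "\<dots> = head_mass g x + x\<^sup>2 * tail_mass g x"
    using int by (subst Bochner_Integration.integral_add)
      (auto simp: head_mass_alt tail_mass_alt[OF x])
  finally show ?thesis .
qed

text \<open>Swap the kernel \<open>2 / y ^ 3\<close> on \<open>max 1 (s / x) \<le> y\<close>. Its
  \<open>y\<close>-integral is the clamped weight min(1, \<open>x\<^sup>2 / s\<^sup>2\<close>); for
  fixed \<open>y \<ge> 1\<close> the condition reads \<open>s \<le> x * y\<close>, so the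
  \<open>s\<close>-integral is a head mass.\<close>

lemma clamped_by_head_mass:
  assumes x: "0 < x"
  shows "head_mass g x / x + x * tail_mass g x
    = (LINT y|lborel. (if 1 \<le> y then 2 / y\<^sup>2 else 0) * (head_mass g (x * y) / (x * y)))"
    (is "_ = ?J")
proof -
  let ?k = "\<lambda>s y. if max 1 (s / x) \<le> y then 2 / y ^ 3 else (0::real)"
  have "(LINT y|lborel. LINT s|lborel. g s * ?k s y)
      = (LINT s|lborel. g s * (if s \<le> x then 1 else x\<^sup>2 / s\<^sup>2))"
  proof (rule integral_kernel_swap[where C = 1])
    show "(if s \<le> x then 1 else x\<^sup>2 / s\<^sup>2) \<le> 1" for s
      using x by (auto intro!: power_mono)
    fix s :: real assume s: "0 < s"
    show "0 \<le> ?k s y" for y by auto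
    have "has_bochner_integral lborel (?k s) (0 - (- 1 / (max 1 (s / x))\<^sup>2))"
    proof (rule has_bochner_integral_FTC_atLeast)
      show "((\<lambda>y. - 1 / y\<^sup>2) has_real_derivative 2 / y ^ 3) (at y)" if "max 1 (s / x) \<le> y" for y
        using that by (auto intro!: derivative_eq_intros simp: field_simps power2_eq_square power3_eq_cube)
      show "((\<lambda>y::real. - 1 / y\<^sup>2) \<longlongrightarrow> 0) at_top" by real_asymp
    qed auto
    moreover have "0 - (- 1 / (max 1 (s / x))\<^sup>2) = (if s \<le> x then 1 else x\<^sup>2 / s\<^sup>2)"
      using x s by (auto simp: max_def field_simps)
    ultimately show "has_bochner_integral lborel (?k s) (if s \<le> x then 1 else x\<^sup>2 / s\<^sup>2)" by simp
  qed measurable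
  moreover have "(LINT s|lborel. g s * ?k s y) = (if 1 \<le> y then 2 / y ^ 3 else 0) * head_mass g (x * y)" for y
  proof -
    have "(LINT s|lborel. g s * ?k s y)
        = (LINT s|lborel. (if 1 \<le> y then 2 / y ^ 3 else 0) * (g s * (if s \<le> x * y then 1 else 0)))"
      using x by (intro Bochner_Integration.integral_cong) (auto simp: field_simps)
    then show ?thesis by (simp add: head_mass_alt)
  qed
  ultimately have "head_mass g x + x\<^sup>2 * tail_mass g x
      = (LINT y|lborel. (if 1 \<le> y then 2 / y ^ 3 else 0) * head_mass g (x * y))"
    using integral_clamped[OF x] by simp
  also have "\<dots> = (LINT y|lborel. x * ((if 1 \<le> y then 2 / y\<^sup>2 else 0) * (head_mass g (x * y) / (x * y))))"
    using x by (intro Bochner_Integration.integral_cong) (auto simp: power2_eq_square power3_eq_cube)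
  finally have "head_mass g x + x\<^sup>2 * tail_mass g x = x * ?J"
    by (simp only: integral_mult_right_zero)
  then have "(head_mass g x + x\<^sup>2 * tail_mass g x) / x = ?J" using x by simp
  then show ?thesis using x by (simp add: add_divide_distrib power2_eq_square)
qed

text \<open>Swap the kernel \<open>2 * y * x\<^sup>2 / s\<^sup>2\<close> on
  \<open>0 < y \<and> y \<le> min 1 (s / x)\<close>. Its \<open>y\<close>-integral is the same
  clamped weight, while for fixed \<open>y\<close> in (0, 1] the condition reads
  \<open>x * y \<le> s\<close> and produces a tail mass.\<close>

lemma clamped_by_tail_mass:
  assumes x: "0 < x"
  shows "head_mass g x / x + x * tail_mass g x
    = (LINT y|lborel. (if 0 < y \<and> y \<le> 1 then 2 else 0) * (x * y * tail_mass g (x * y)))"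
    (is "_ = ?J")
proof -
  let ?k = "\<lambda>s y. if 0 < y \<and> y \<le> min 1 (s / x) then 2 * y * x\<^sup>2 / s\<^sup>2 else (0::real)"
  have "(LINT y|lborel. LINT s|lborel. g s * ?k s y)
      = (LINT s|lborel. g s * (if s \<le> x then 1 else x\<^sup>2 / s\<^sup>2))"
  proof (rule integral_kernel_swap[where C = 1])
    show "(if s \<le> x then 1 else x\<^sup>2 / s\<^sup>2) \<le> 1" for s
      using x by (auto intro!: power_mono)
    fix s :: real assume s: "0 < s"
    show "0 \<le> ?k s y" for y by auto
    let ?b = "min 1 (s / x)"
    define C where "C = x\<^sup>2 / s\<^sup>2"
    then have "0 \<le> C" by simp
    then have "has_bochner_integral lborel (\<lambda>y. (2 * y * C) * indicator {0..?b} y) (?b\<^sup>2 * C - 0\<^sup>2 * C)"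
      using x s by (intro has_bochner_integral_FTC_Icc_nonneg)
        (auto intro!: derivative_eq_intros)
    \<comment> \<open>Including the endpoint \<open>y = 0\<close> changes nothing, since the
      integrand is 0 there.\<close>
    moreover have "(\<lambda>y. (2 * y * C) * indicator {0..?b} y) = ?k s"
      by (rule ext) (auto simp: indicator_def C_def)
    moreover have "?b\<^sup>2 * C - 0\<^sup>2 * C = (if s \<le> x then 1 else x\<^sup>2 / s\<^sup>2)"
      using x s by (auto simp: min_def field_simps C_def)
    ultimately show "has_bochner_integral lborel (?k s) (if s \<le> x then 1 else x\<^sup>2 / s\<^sup>2)"
      by simp
  qed measurable
  moreover have "(LINT s|lborel. g s * ?k s y)
      = (if 0 < y \<and> y \<le> 1 then 2 else 0) * (x\<^sup>2 * y * tail_mass g (x * y))" for y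
  proof (cases "0 < y \<and> y \<le> 1")
    case True
    then have "(LINT s|lborel. g s * ?k s y)
        = (LINT s|lborel. (2 * x\<^sup>2 * y) * (g s * (if x * y \<le> s then 1 / s\<^sup>2 else 0)))"
      using x by (intro Bochner_Integration.integral_cong) (auto simp: field_simps)
    then show ?thesis using True x by (simp add: tail_mass_alt)
  qed auto
  ultimately have "head_mass g x + x\<^sup>2 * tail_mass g x
      = (LINT y|lborel. (if 0 < y \<and> y \<le> 1 then 2 else 0) * (x\<^sup>2 * y * tail_mass g (x * y)))"
    using integral_clamped[OF x] by simp
  also have "\<dots> = (LINT y|lborel. x * ((if 0 < y \<and> y \<le> 1 then 2 else 0) * (x * y * tail_mass g (x * y))))"
    by (intro Bochner_Integration.integral_cong) (auto simp: power2_eq_square)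
  finally have "head_mass g x + x\<^sup>2 * tail_mass g x = x * ?J"
    by (simp only: integral_mult_right_zero)
  then have "(head_mass g x + x\<^sup>2 * tail_mass g x) / x = ?J" using x by simp
  then show ?thesis using x by (simp add: add_divide_distrib power2_eq_square)
qed

section \<open>Equivalence of the head and tail limits\<close>

lemma head_mass_mean_decay: "0 < u \<Longrightarrow> head_mass g u / u \<le> integral\<^sup>L lborel g / u"
  using head_mass_le by (intro divide_right_mono) auto

lemma head_mass_mean_nonneg: "0 < u \<Longrightarrow> 0 \<le> head_mass g u / u"
  using head_mass_nonneg[of u] by simp

text \<open>The weight \<open>2 / y\<^sup>2\<close> on [1, \<infinity>) has total mass 2, whence the
  factor 2.\<close>

lemma clamped_limit_of_head_mass:
  assumes "((\<lambda>x. head_mass g x / x) \<longlongrightarrow> v) (at_right 0)"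
  shows "((\<lambda>x. head_mass g x / x + x * tail_mass g x) \<longlongrightarrow> 2 * v) (at_right 0)"
proof -
  have w: "has_bochner_integral lborel (\<lambda>y. if 1 \<le> y then 2 / y\<^sup>2 else 0) (0 - (- 2 / (1::real)))"
  proof (rule has_bochner_integral_FTC_atLeast)
    show "((\<lambda>y. - 2 / y) has_real_derivative 2 / y\<^sup>2) (at y)" if "1 \<le> y" for y :: real
      using that by (auto intro!: derivative_eq_intros simp: power2_eq_square)
    show "((\<lambda>y::real. - 2 / y) \<longlongrightarrow> 0) at_top" by real_asymp
  qed auto
  have "((\<lambda>x. LINT y|lborel. (if 1 \<le> y then 2 / y\<^sup>2 else 0) * (head_mass g (x * y) / (x * y)))
      \<longlongrightarrow> 2 * v) (at_right 0)"
    using w by (intro abelian_averaging[OF _ head_mass_mean_nonneg head_mass_mean_decay assms]) auto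
  then show ?thesis
    by (rule Lim_transform_eventually)
      (auto simp: eventually_at_filter clamped_by_head_mass)
qed

text \<open>The weight is 2 on (0, 1], again of total mass 2; the decay needed for averaging is
  \<open>tail_mass_le\<close> multiplied by \<open>u\<close>.\<close>

lemma clamped_limit_of_tail_mass:
  assumes "((\<lambda>x. x * tail_mass g x) \<longlongrightarrow> v) (at_right 0)"
  shows "((\<lambda>x. head_mass g x / x + x * tail_mass g x) \<longlongrightarrow> 2 * v) (at_right 0)"
proof -
  have "has_bochner_integral lborel (indicator {0<..1::real}) (1::real)"
    using has_bochner_integral_real_indicator[of "{0<..1::real}" lborel] by (simp add: measure_def)
  then have "has_bochner_integral lborel (\<lambda>y::real. 2 * indicator {0<..1} y) (2 * 1 :: real)"
    by (intro has_bochner_integral_mult_right)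
  moreover have "(\<lambda>y. 2 * indicator {0<..1} y) = (\<lambda>y::real. if 0 < y \<and> y \<le> 1 then 2 else 0 :: real)"
    by (auto simp: indicator_def)
  moreover have "u * tail_mass g u \<le> integral\<^sup>L lborel g / u" if "0 < u" for u
    using tail_mass_le[OF that] that by (simp add: field_simps power2_eq_square)
  ultimately have "((\<lambda>x. LINT y|lborel. (if 0 < y \<and> y \<le> 1 then 2 else 0) * (x * y * tail_mass g (x * y)))
      \<longlongrightarrow> 2 * v) (at_right 0)"
    using tail_mass_nonneg by (intro abelian_averaging[OF _ _ _ assms]) auto
  then show ?thesis
    by (rule Lim_transform_eventually)
      (auto simp: eventually_at_filter clamped_by_tail_mass)
qed

text \<open>Either limit forces the sum of the two quantities to tend to \<open>2 * v\<close>;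
  subtracting the known one leaves the other.\<close>

lemma head_mass_limit_iff_tail_mass_limit:
  "((\<lambda>x. head_mass g x / x) \<longlongrightarrow> v) (at_right 0) \<longleftrightarrow> ((\<lambda>x. x * tail_mass g x) \<longlongrightarrow> v) (at_right 0)"
proof
  assume h: "((\<lambda>x. head_mass g x / x) \<longlongrightarrow> v) (at_right 0)"
  from tendsto_diff[OF clamped_limit_of_head_mass[OF h] h]
  show "((\<lambda>x. x * tail_mass g x) \<longlongrightarrow> v) (at_right 0)" by simp
next
  assume h: "((\<lambda>x. x * tail_mass g x) \<longlongrightarrow> v) (at_right 0)"
  from tendsto_diff[OF clamped_limit_of_tail_mass[OF h] h]
  show "((\<lambda>x. head_mass g x / x) \<longlongrightarrow> v) (at_right 0)" by simp
qed

section \<open>Abelian direction: from the head limit to the Laplace limit\<close>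

lemma laplace_mean_by_head_mass:
  assumes t: "0 < t"
  shows "laplace_mean g t
    = (LINT y|lborel. (if 0 \<le> y then y * exp (- y) else 0) * (head_mass g (inverse t * y) / (inverse t * y)))"
proof -
  \<comment> \<open>The \<open>y\<close>-integral of this kernel is
    \<open>t * exp (- t * s)\<close>; for fixed \<open>y\<close> the condition
    \<open>s \<le> inverse t * y\<close> yields a head mass.\<close>
  let ?k = "\<lambda>s y. if t * s \<le> y then t * exp (- y) else 0"
  have "(LINT y|lborel. LINT s|lborel. g s * ?k s y) = (LINT s|lborel. g s * (t * exp (- t * s)))"
  proof (rule integral_kernel_swap[where C = t])
    fix s :: real assume s: "0 < s"
    show "t * exp (- t * s) \<le> t" using s t by simp
    show "0 \<le> ?k s y" for y using t by simp
    have "has_bochner_integral lborel (?k s) (0 - (- t * exp (- (t * s))))"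
    proof (rule has_bochner_integral_FTC_atLeast)
      show "((\<lambda>y. - t * exp (- y)) has_real_derivative t * exp (- y)) (at y)" for y
        by (auto intro!: derivative_eq_intros)
      show "((\<lambda>y::real. - t * exp (- y)) \<longlongrightarrow> 0) at_top" by real_asymp
    qed (use t in auto)
    then show "has_bochner_integral lborel (?k s) (t * exp (- t * s))" by simp
  qed measurable
  moreover have "(LINT s|lborel. g s * ?k s y)
      = (if 0 \<le> y then y * exp (- y) else 0) * (head_mass g (inverse t * y) / (inverse t * y))" for y
  proof -
    have "(LINT s|lborel. g s * ?k s y)
        = (LINT s|lborel. (if 0 \<le> y then t * exp (- y) else 0) * (g s * (if s \<le> inverse t * y then 1 else 0)))"
    proof (intro Bochner_Integration.integral_cong)
      fix s
      show "g s * ?k s y = (if 0 \<le> y then t * exp (- y) else 0) * (g s * (if s \<le> inverse t * y then 1 else 0))"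
      proof (cases "0 < s")
        case True
        \<comment> \<open>On the support of \<open>g\<close> the kernel is nonzero only for
          \<open>y \<ge> 0\<close>, so the guard \<open>0 \<le> y\<close> may be inserted.\<close>
        then have "0 \<le> y" if "t * s \<le> y" using that t by (meson mult_nonneg_nonneg less_imp_le order_trans)
        then show ?thesis using t by (auto simp: field_simps)
      qed (simp add: g_zero)
    qed simp
    also have "\<dots> = (if 0 \<le> y then t * exp (- y) else 0) * head_mass g (inverse t * y)"
      by (simp add: head_mass_alt)
    also have "\<dots> = (if 0 \<le> y then y * exp (- y) else 0) * (head_mass g (inverse t * y) / (inverse t * y))"
      \<comment> \<open>At \<open>y = 0\<close> the quotient on the right divides by 0, but both
        sides are 0 because \<open>head_mass g 0 = 0\<close>.\<close>
      using t head_mass_0 by (auto simp: field_simps)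
    finally show ?thesis .
  qed
  ultimately show ?thesis
    by (simp add: laplace_mean_def mult.left_commute)
qed

lemma laplace_mean_limit_of_head_mass:
  assumes "((\<lambda>x. head_mass g x / x) \<longlongrightarrow> v) (at_right 0)"
  shows "(laplace_mean g \<longlongrightarrow> v) at_top"
proof -
  \<comment> \<open>The total mass of the weight is 1, read off from the antiderivative
    \<open>- (y + 1) * exp (- y)\<close>.\<close>
  have w: "has_bochner_integral lborel (\<lambda>y. if 0 \<le> y then y * exp (- y) else 0) (0 - (- (0 + 1) * exp (- (0::real))))"
  proof (rule has_bochner_integral_FTC_atLeast)
    show "((\<lambda>y. - (y + 1) * exp (- y)) has_real_derivative y * exp (- y)) (at y)" for y :: real
      by (auto intro!: derivative_eq_intros simp: algebra_simps)
    show "((\<lambda>y::real. - (y + 1) * exp (- y)) \<longlongrightarrow> 0) at_top" by real_asymp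
  qed auto
  have "((\<lambda>x. LINT y|lborel. (if 0 \<le> y then y * exp (- y) else 0) * (head_mass g (x * y) / (x * y)))
      \<longlongrightarrow> 1 * v) (at_right 0)"
    using w by (intro abelian_averaging[OF _ head_mass_mean_nonneg head_mass_mean_decay assms]) auto
  then have "((\<lambda>t. LINT y|lborel. (if 0 \<le> y then y * exp (- y) else 0)
      * (head_mass g (inverse t * y) / (inverse t * y))) \<longlongrightarrow> v) at_top"
    by (simp only: filterlim_at_right_to_top mult_1)
  moreover have "\<forall>\<^sub>F t in at_top. (LINT y|lborel. (if 0 \<le> y then y * exp (- y) else 0)
      * (head_mass g (inverse t * y) / (inverse t * y))) = laplace_mean g t"
    using eventually_gt_at_top[of 0] by eventually_elim (rule laplace_mean_by_head_mass[symmetric])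
  ultimately show ?thesis by (rule Lim_transform_eventually)
qed

section \<open>Karamata's Tauberian argument: from the Laplace limit to the head limit\<close>

lemma integrable_weighted:
  assumes q: "continuous_on UNIV q" and t: "0 < t"
  shows "integrable lborel (\<lambda>s. g s * (exp (- t * s) * q (exp (- t * s))))"
proof -
  have [measurable]: "q \<in> borel_measurable borel"
    using q by (rule borel_measurable_continuous_onI)
  \<comment> \<open>For positive \<open>s\<close> the value \<open>exp (- t * s)\<close> lies in
    [0, 1], so a bound for \<open>q\<close> on this compact interval suffices.\<close>
  have "compact (q ` {0..1})"
    using continuous_on_subset[OF q] by (intro compact_continuous_image) auto
  then obtain B where "\<forall>z\<in>q ` {0..1}. norm z \<le> B"
    using compact_imp_bounded bounded_iff by blast
  then have B: "\<bar>q y\<bar> \<le> B" if "y \<in> {0..1}" for y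
    using that by simp
  show ?thesis
  proof (rule integrable_mult_g)
    fix s :: real assume "0 < s"
    then have "exp (- t * s) \<in> {0..1}" using t by simp
    then show "\<bar>exp (- t * s) * q (exp (- t * s))\<bar> \<le> 1 * B"
      unfolding abs_mult by (intro mult_mono B) auto
  qed measurable
qed

lemma integrable_laplace: "0 < t \<Longrightarrow> integrable lborel (\<lambda>s. g s * exp (- t * s))"
  using integrable_weighted[of "\<lambda>_. 1" t] by simp

text \<open>The exponentials combine to rate \<open>Suc i * t\<close>; dividing by
  \<open>Suc i\<close> corrects the prefactor \<open>t\<close>, and \<open>1 / Suc i\<close> is also
  the integral of \<open>y ^ i\<close> over [0, 1].\<close>

lemma weighted_mean_power:
  assumes "0 < t"
  shows "weighted_mean g (\<lambda>y. y ^ i) t = laplace_mean g (real (Suc i) * t) / real (Suc i)"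
proof -
  have "exp (- t * s) * exp (- t * s) ^ i = exp (- (real (Suc i) * t) * s)" for s
    by (simp add: exp_of_nat_mult[symmetric] exp_add[symmetric] algebra_simps)
  then show ?thesis by (simp add: weighted_mean_def laplace_mean_def)
qed

lemma weighted_mean_sum:
  assumes "0 < t"
  shows "weighted_mean g (\<lambda>y. \<Sum>i\<le>n. a i * y ^ i) t = (\<Sum>i\<le>n. a i * weighted_mean g (\<lambda>y. y ^ i) t)"
proof -
  have int: "integrable lborel (\<lambda>s. g s * (exp (- t * s) * exp (- t * s) ^ i))" for i
    by (rule integrable_weighted[OF _ assms]) (intro continuous_intros)
  have "(LINT s|lborel. g s * (exp (- t * s) * (\<Sum>i\<le>n. a i * exp (- t * s) ^ i)))
      = (LINT s|lborel. (\<Sum>i\<le>n. a i * (g s * (exp (- t * s) * exp (- t * s) ^ i))))"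
    by (simp only: sum_distrib_left mult_ac)
  also have "\<dots> = (\<Sum>i\<le>n. LINT s|lborel. a i * (g s * (exp (- t * s) * exp (- t * s) ^ i)))"
    using int by (intro Bochner_Integration.integral_sum) auto
  finally show ?thesis
    by (simp add: weighted_mean_def sum_distrib_left mult.left_commute)
qed

lemma weighted_mean_limit_polynomial:
  assumes lim: "(laplace_mean g \<longlongrightarrow> v) at_top"
  shows "(weighted_mean g (\<lambda>y. \<Sum>i\<le>n. a i * y ^ i)
    \<longlongrightarrow> v * integral {0..1} (\<lambda>y. \<Sum>i\<le>n. a i * y ^ i)) at_top"
proof -
  have "((\<lambda>y::real. y ^ i) has_integral 1 ^ Suc i / Suc i - 0 ^ Suc i / Suc i) {0..1}" for i
  proof (rule fundamental_theorem_of_calculus)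
    fix y :: real
    have "((\<lambda>y. y ^ Suc i / real (Suc i)) has_real_derivative
        real (Suc i) * y ^ (Suc i - Suc 0) / real (Suc i)) (at y within {0..1})"
      by (rule DERIV_cdivide[OF DERIV_subset[OF DERIV_pow subset_UNIV]])
    then show "((\<lambda>y. y ^ Suc i / real (Suc i)) has_vector_derivative y ^ i) (at y within {0..1})"
      by (simp add: has_real_derivative_iff_has_vector_derivative)
  qed simp
  then have "((\<lambda>y::real. \<Sum>i\<le>n. a i * y ^ i) has_integral (\<Sum>i\<le>n. a i * (1 / Suc i))) {0..1}"
    by (intro has_integral_sum has_integral_mult_right) auto
  then have I: "integral {0..1} (\<lambda>y. \<Sum>i\<le>n. a i * y ^ i) = (\<Sum>i\<le>n. a i * (1 / Suc i))"
    by (rule integral_unique)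
  have "((\<lambda>t. laplace_mean g (real (Suc i) * t) / real (Suc i)) \<longlongrightarrow> v / real (Suc i)) at_top" for i
  proof (intro tendsto_divide filterlim_compose[OF lim])
    show "LIM t at_top. real (Suc i) * t :> at_top"
      by (rule filterlim_tendsto_pos_mult_at_top[OF tendsto_const _ filterlim_ident]) auto
  qed auto
  then have "((\<lambda>t. \<Sum>i\<le>n. a i * (laplace_mean g (real (Suc i) * t) / real (Suc i)))
      \<longlongrightarrow> (\<Sum>i\<le>n. a i * (v / real (Suc i)))) at_top"
    by (intro tendsto_sum tendsto_mult_left)
  moreover have "(\<Sum>i\<le>n. a i * (v / real (Suc i))) = v * integral {0..1} (\<lambda>y. \<Sum>i\<le>n. a i * y ^ i)"
    unfolding I by (simp add: sum_distrib_left field_simps)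
  moreover have "\<forall>\<^sub>F t in at_top. (\<Sum>i\<le>n. a i * (laplace_mean g (real (Suc i) * t) / real (Suc i)))
      = weighted_mean g (\<lambda>y. \<Sum>i\<le>n. a i * y ^ i) t"
    using eventually_gt_at_top[of 0]
    by eventually_elim (simp only: weighted_mean_sum weighted_mean_power)
  ultimately show ?thesis by (simp only: tendsto_cong)
qed

text \<open>The Laplace mean is the weighted mean of the constant 1, so it converts uniform
  closeness on [0, 1] into closeness of means.\<close>

lemma weighted_mean_diff_le:
  assumes q: "continuous_on UNIV q" and r: "continuous_on UNIV r" and t: "0 < t"
    and close: "\<And>y. y \<in> {0..1} \<Longrightarrow> \<bar>q y - r y\<bar> \<le> e"
  shows "\<bar>weighted_mean g q t - weighted_mean g r t\<bar> \<le> e * laplace_mean g t"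
proof -
  let ?d = "\<lambda>s. g s * (exp (- t * s) * q (exp (- t * s))) - g s * (exp (- t * s) * r (exp (- t * s)))"
  note int_qr = integrable_weighted[OF q t] integrable_weighted[OF r t]
  have int: "integrable lborel ?d"
    by (rule Bochner_Integration.integrable_diff[OF int_qr])
  have "\<bar>LINT s|lborel. ?d s\<bar> \<le> (LINT s|lborel. e * (g s * exp (- t * s)))"
  proof (rule order_trans[OF integral_abs_bound integral_mono])
    fix s
    show "\<bar>?d s\<bar> \<le> e * (g s * exp (- t * s))"
    proof (cases "0 < s")
      case True
      have "?d s = (g s * exp (- t * s)) * (q (exp (- t * s)) - r (exp (- t * s)))"
        by (simp add: algebra_simps)
      then have "\<bar>?d s\<bar> = (g s * exp (- t * s)) * \<bar>q (exp (- t * s)) - r (exp (- t * s))\<bar>"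
        using g_nonneg[of s] by (simp add: abs_mult)
      also have "\<dots> \<le> (g s * exp (- t * s)) * e"
        using g_nonneg[of s] t True by (intro mult_left_mono close) auto
      finally show ?thesis by (simp add: mult.commute)
    qed (simp add: g_zero)
  qed (use int integrable_laplace[OF t] in auto)
  then have "t * \<bar>LINT s|lborel. ?d s\<bar> \<le> t * (e * (LINT s|lborel. g s * exp (- t * s)))"
    using t by (intro mult_left_mono) auto
  moreover have "weighted_mean g q t - weighted_mean g r t = t * (LINT s|lborel. ?d s)"
    by (simp only: Bochner_Integration.integral_diff[OF int_qr] weighted_mean_def right_diff_distrib)
  ultimately show ?thesis
    using t by (simp add: abs_mult laplace_mean_def mult.left_commute)
qed

text \<open>Weierstrass: a polynomial \<open>r\<close> uniformly close to \<open>q\<close> on [0, 1]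
  has the right limit, and replacing \<open>q\<close> by \<open>r\<close> costs little because the
  Laplace mean stays bounded for large \<open>t\<close>.\<close>

lemma weighted_mean_limit_continuous:
  assumes lim: "(laplace_mean g \<longlongrightarrow> v) at_top" and q: "continuous_on UNIV q"
  shows "(weighted_mean g q \<longlongrightarrow> v * integral {0..1} q) at_top"
proof (rule tendstoI)
  fix e :: real assume e: "0 < e"
  \<comment> \<open>Three errors occur: \<open>d * (\<bar>v\<bar> + 1)\<close> between the means,
    \<open>d\<close> in the polynomial limit and \<open>\<bar>v\<bar> * d\<close> between the
    integrals. They add up to \<open>2 * (d * (\<bar>v\<bar> + 1))\<close>, which is
    \<open>2 * e / 3\<close>.\<close>
  define d where "d = e / 3 / (\<bar>v\<bar> + 1)"
  have nz: "\<bar>v\<bar> + 1 \<noteq> 0" by linarith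
  have d: "0 < d" using e by (simp add: d_def)
  obtain r where rp: "real_polynomial_function r" and close: "\<And>y. y \<in> {0..1} \<Longrightarrow> \<bar>q y - r y\<bar> < d"
    using Stone_Weierstrass_real_polynomial_function[OF compact_Icc continuous_on_subset[OF q] d] by blast
  obtain a n where r: "r = (\<lambda>y. \<Sum>i\<le>n. a i * y ^ i)"
    using rp by (auto simp: real_polynomial_function_iff_sum)
  have rc: "continuous_on UNIV r" unfolding r by (intro continuous_intros)
  have "\<bar>integral {0..1} q - integral {0..1} r\<bar> \<le> d"
  proof -
    have "norm (integral {0..1} (\<lambda>y. q y - r y)) \<le> d * (1 - 0)"
      using close continuous_on_subset[OF q] continuous_on_subset[OF rc]
      by (intro integral_bound continuous_intros) (auto intro: less_imp_le)
    then show ?thesis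
      using continuous_on_subset[OF q] continuous_on_subset[OF rc]
      by (subst (asm) Henstock_Kurzweil_Integration.integral_diff) (auto intro!: integrable_continuous_real)
  qed
  then have "\<bar>v\<bar> * \<bar>integral {0..1} q - integral {0..1} r\<bar> \<le> \<bar>v\<bar> * d"
    by (intro mult_left_mono) auto
  then have I: "\<bar>v * integral {0..1} r - v * integral {0..1} q\<bar> \<le> \<bar>v\<bar> * d"
    by (simp add: abs_mult[symmetric] right_diff_distrib abs_minus_commute)
  have "(weighted_mean g r \<longlongrightarrow> v * integral {0..1} r) at_top"
    unfolding r by (rule weighted_mean_limit_polynomial[OF lim])
  then have "\<forall>\<^sub>F t in at_top. dist (weighted_mean g r t) (v * integral {0..1} r) < d"
    using d by (rule tendstoD)
  moreover have "\<forall>\<^sub>F t in at_top. laplace_mean g t < \<bar>v\<bar> + 1"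
    using lim by (rule order_tendstoD) linarith
  ultimately show "\<forall>\<^sub>F t in at_top. dist (weighted_mean g q t) (v * integral {0..1} q) < e"
    using eventually_gt_at_top[of 0]
  proof eventually_elim
    case (elim t)
    have "\<bar>weighted_mean g q t - weighted_mean g r t\<bar> \<le> d * laplace_mean g t"
      using close by (intro weighted_mean_diff_le q rc elim) (auto intro: less_imp_le)
    also have "\<dots> \<le> d * (\<bar>v\<bar> + 1)" using d elim by (intro mult_left_mono) auto
    finally have "\<bar>weighted_mean g q t - v * integral {0..1} q\<bar> < d * (\<bar>v\<bar> + 1) + d + \<bar>v\<bar> * d"
      using I elim unfolding dist_real_def by linarith
    also have "\<dots> = 2 * (d * (\<bar>v\<bar> + 1))" by (simp add: algebra_simps)
    also have "d * (\<bar>v\<bar> + 1) = e / 3"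
      by (rule iffD1[OF nonzero_eq_divide_eq[OF nz] d_def])
    finally show ?case using e by (simp add: dist_real_def)
  qed
qed

text \<open>Multiplied by \<open>y\<close>, a ramp quotient is just the ramp for
  \<open>y \<ge> exp (- 1)\<close>. The first ramp vanishes below this level and is at most 1 above
  it; the second has already reached 1 there and is nonnegative below.\<close>

lemma head_mass_sandwich:
  assumes t: "0 < t" and d: "0 < d"
  shows "weighted_mean g (\<lambda>y. ramp ((y - exp (- 1)) / d) / max (exp (- 1)) y) t \<le> t * head_mass g (inverse t)" (is ?low)
    and "t * head_mass g (inverse t) \<le> weighted_mean g (\<lambda>y. ramp ((y - (exp (- 1) - d)) / d) / max (exp (- 1)) y) t" (is ?up)
proof -
  \<comment> \<open>The head cutoff at \<open>inverse t\<close> becomes the level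
    \<open>exp (- 1)\<close> in the variable \<open>exp (- t * s)\<close>.\<close>
  have cut: "s \<le> inverse t \<longleftrightarrow> exp (- 1) \<le> exp (- t * s)" for s
    using t by (simp add: field_simps)
  show ?low
    unfolding weighted_mean_def head_mass_alt
  proof (intro mult_left_mono integral_mono integrable_weighted integrable_head continuous_ramp_quotient t d)
    fix s
    let ?y = "exp (- t * s)"
    show "?y * (ramp ((?y - exp (- 1)) / d) / max (exp (- 1)) ?y) \<le> (if s \<le> inverse t then 1 else 0)"
      using d by (auto simp: cut max_def ramp_simps divide_nonpos_pos)
  qed (use t g_nonneg in auto)
  show ?up
    unfolding weighted_mean_def head_mass_alt
  proof (intro mult_left_mono integral_mono integrable_weighted integrable_head continuous_ramp_quotient t d)
    fix s
    let ?y = "exp (- t * s)"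
    show "(if s \<le> inverse t then 1 else 0) \<le> ?y * (ramp ((?y - (exp (- 1) - d)) / d) / max (exp (- 1)) ?y)"
      using d by (auto simp: cut max_def ramp_simps)
  qed (use t g_nonneg in auto)
qed

lemma head_mass_limit_of_laplace_mean:
  assumes lim: "(laplace_mean g \<longlongrightarrow> v) at_top"
  shows "((\<lambda>x. head_mass g x / x) \<longlongrightarrow> v) (at_right 0)"
proof -
  define c :: real where "c = exp (- 1)"
  have c: "0 < c" "c < 1" by (simp_all add: c_def)
  have "0 \<le> laplace_mean g t" if "0 < t" for t
    unfolding laplace_mean_def using that g_nonneg
    by (intro mult_nonneg_nonneg integral_nonneg_AE) auto
  \<comment> \<open>The sign of \<open>v\<close> lets the bounds on the ramp integrals be multiplied
    by \<open>v\<close>.\<close>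
  then have v: "0 \<le> v"
    by (intro tendsto_lowerbound[OF lim] eventually_mono[OF eventually_gt_at_top[of 0]]) auto
  have small: "\<forall>\<^sub>F d in at_right 0. 0 < d \<and> d \<le> c \<and> c + d \<le> 1"
    unfolding eventually_at_right_field using c by (intro exI[of _ "min c (1 - c)"]) auto
  have "((\<lambda>t. t * head_mass g (inverse t)) \<longlongrightarrow> v) at_top"
  proof (rule order_tendstoI)
    fix a assume "a < v"
    \<comment> \<open>As the ramp narrows, its lower integral bound times \<open>v\<close> tends to
      \<open>v\<close>, so some admissible width \<open>d\<close> keeps it above
      \<open>a\<close>.\<close>
    moreover have "((\<lambda>d. v * (1 - d / c)) \<longlongrightarrow> v * (1 - 0 / c)) (at_right 0)"
      using c by (intro tendsto_intros) auto
    ultimately have "\<forall>\<^sub>F d in at_right 0. a < v * (1 - d / c)"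
      by (intro order_tendstoD) auto
    with small have "\<forall>\<^sub>F d in at_right 0. (0 < d \<and> d \<le> c \<and> c + d \<le> 1) \<and> a < v * (1 - d / c)"
      by (rule eventually_conj)
    from eventually_happens'[OF trivial_limit_at_right_real this]
    obtain d where d: "0 < d" "d \<le> c" "c + d \<le> 1" "a < v * (1 - d / c)"
      by blast
    let ?q = "\<lambda>y. ramp ((y - c) / d) / max c y"
    have "v * (1 - d / c) \<le> v * integral {0..1} ?q"
      using integral_ramp_quotient(1)[of d] d v by (intro mult_left_mono) (auto simp: c_def)
    then have "\<forall>\<^sub>F t in at_top. a < weighted_mean g ?q t"
      using d c by (intro order_tendstoD(1)[OF weighted_mean_limit_continuous[OF lim]]
          continuous_ramp_quotient) auto
    then show "\<forall>\<^sub>F t in at_top. a < t * head_mass g (inverse t)"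
      using eventually_gt_at_top[of 0]
      by eventually_elim
        (use head_mass_sandwich(1)[OF _ d(1)] in \<open>auto simp: c_def intro: less_le_trans\<close>)
  next
    fix a assume "v < a"
    \<comment> \<open>Symmetrically, a narrow ramp keeps the upper bound below
      \<open>a\<close>.\<close>
    moreover have "((\<lambda>d. v * (1 + d / c)) \<longlongrightarrow> v * (1 + 0 / c)) (at_right 0)"
      using c by (intro tendsto_intros) auto
    ultimately have "\<forall>\<^sub>F d in at_right 0. v * (1 + d / c) < a"
      by (intro order_tendstoD) auto
    with small have "\<forall>\<^sub>F d in at_right 0. (0 < d \<and> d \<le> c \<and> c + d \<le> 1) \<and> v * (1 + d / c) < a"
      by (rule eventually_conj)
    from eventually_happens'[OF trivial_limit_at_right_real this]
    obtain d where d: "0 < d" "d \<le> c" "c + d \<le> 1" "v * (1 + d / c) < a"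
      by blast
    let ?q = "\<lambda>y. ramp ((y - (c - d)) / d) / max c y"
    have "v * integral {0..1} ?q \<le> v * (1 + d / c)"
      using integral_ramp_quotient(2)[of d] d v by (intro mult_left_mono) (auto simp: c_def)
    then have "\<forall>\<^sub>F t in at_top. weighted_mean g ?q t < a"
      using d c by (intro order_tendstoD(2)[OF weighted_mean_limit_continuous[OF lim]]
          continuous_ramp_quotient) auto
    then show "\<forall>\<^sub>F t in at_top. t * head_mass g (inverse t) < a"
      using eventually_gt_at_top[of 0]
      by eventually_elim
        (use head_mass_sandwich(2)[OF _ d(1)] in \<open>auto simp: c_def intro: le_less_trans\<close>)
  qed
  then show ?thesis
    by (simp add: filterlim_at_right_to_top divide_inverse mult.commute)
qed

lemma head_mass_limit_iff_laplace_mean_limit: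
  "((\<lambda>x. head_mass g x / x) \<longlongrightarrow> v) (at_right 0) \<longleftrightarrow> (laplace_mean g \<longlongrightarrow> v) at_top"
  using head_mass_limit_of_laplace_mean laplace_mean_limit_of_head_mass by blast

end

section \<open>The occupancy variance as a Laplace mean\<close>

lemma Delta_nu_nonpos:
  assumes "\<And>j. 0 < p j" "x \<le> 0"
  shows "Delta_nu p x = 0"
proof -
  have "\<not> p j \<le> x" for j using assms(1)[of j] assms(2) by linarith
  then show ?thesis by (simp add: Delta_nu_def)
qed

text \<open>Each box contributes the integral of \<open>t * exp (- t * u)\<close> over
  \<open>{p j..<2 * p j}\<close>, and these indicators sum to \<open>Delta_nu p u\<close>.
  Nonnegativity reduces the exchange of sum and integral to the summability of the variance
  series.\<close>

lemma V_occ_eq_laplace_mean: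
  fixes p :: "nat \<Rightarrow> real"
  assumes p: "\<And>j. 0 < p j" "summable p" and t: "0 < t"
  shows "V_occ p t = laplace_mean (\<lambda>u. real (Delta_nu p u)) t"
proof -
  let ?f = "\<lambda>j u. t * exp (- t * u) * indicator {p j..<2 * p j} u"
  have box: "has_bochner_integral lborel (?f j) (exp (- t * p j) - exp (- 2 * t * p j))" for j
  proof -
    have "has_bochner_integral lborel (\<lambda>u. t * exp (- t * u) * indicator {p j..2 * p j} u)
        (- exp (- t * (2 * p j)) - - exp (- t * p j))"
      using t p(1)[of j] by (intro has_bochner_integral_FTC_Icc_nonneg)
        (auto intro!: derivative_eq_intros continuous_intros)
    \<comment> \<open>The fundamental theorem is applied on a closed interval; the right endpoint is
      a null set.\<close>
    moreover have "AE u in lborel. t * exp (- t * u) * indicator {p j..2 * p j} u = ?f j u"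
      using AE_lborel_singleton[of "2 * p j"]
      by eventually_elim (auto simp: indicator_def)
    ultimately show ?thesis
      by (subst has_bochner_integral_cong_AE[symmetric]) (auto simp: mult_ac)
  qed
  have series: "(\<lambda>j. ?f j u) sums (t * exp (- t * u) * real (Delta_nu p u))" for u
    using sums_Delta_nu[OF p(2,1)] by (rule sums_mult)
  have "V_occ p t = (\<Sum>j. integral\<^sup>L lborel (?f j))"
    using box by (simp add: V_occ_def has_bochner_integral_iff)
  also have "\<dots> = (LINT u|lborel. (\<Sum>j. ?f j u))"
  proof (rule integral_suminf[symmetric])
    show "integrable lborel (?f j)" for j
      using box by (simp add: has_bochner_integral_iff)
    have norm_f: "norm (?f j u) = ?f j u" for j u
      using t by simp
    show "AE u in lborel. summable (\<lambda>j. norm (?f j u))"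
      unfolding norm_f by (intro AE_I2 sums_summable[OF series])
    show "summable (\<lambda>j. LINT u|lborel. norm (?f j u))"
      unfolding norm_f using box summable_V_occ[OF p(2,1), of t] t
      by (simp add: has_bochner_integral_iff)
  qed
  also have "\<dots> = (LINT u|lborel. t * (real (Delta_nu p u) * exp (- t * u)))"
    using series by (simp add: sums_iff mult_ac)
  finally show ?thesis by (simp add: laplace_mean_def)
qed

theorem theorem5p6:
  fixes p :: "nat \<Rightarrow> real" and v :: real
  assumes "decseq p"
    and "\<And>j. 0 < p j"
    and "summable p"
  shows "(((\<lambda>x. x * (LINT u:{x..}|lborel. real (Delta_nu p u) / u\<^sup>2)) \<longlongrightarrow> v) (at_right 0)
          \<longleftrightarrow> ((\<lambda>x. D_int p x / x) \<longlongrightarrow> v) (at_right 0))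
       \<and> (((\<lambda>x. x * (LINT u:{x..}|lborel. real (Delta_nu p u) / u\<^sup>2)) \<longlongrightarrow> v) (at_right 0)
          \<longleftrightarrow> (V_occ p \<longlongrightarrow> v) at_top)"
proof -
  let ?g = "\<lambda>u. real (Delta_nu p u)"
  have g: "integrable lborel ?g" "\<And>u. 0 \<le> ?g u" "\<And>u. u \<le> 0 \<Longrightarrow> ?g u = 0"
    using integrable_Delta_nu[OF assms(3,2)] Delta_nu_nonpos[OF assms(2)] by auto
  have "((\<lambda>x. x * tail_mass ?g x) \<longlongrightarrow> v) (at_right 0) \<longleftrightarrow> ((\<lambda>x. head_mass ?g x / x) \<longlongrightarrow> v) (at_right 0)"
    using head_mass_limit_iff_tail_mass_limit[OF g] by blast
  moreover have "((\<lambda>x. head_mass ?g x / x) \<longlongrightarrow> v) (at_right 0) \<longleftrightarrow> (laplace_mean ?g \<longlongrightarrow> v) at_top"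
    by (rule head_mass_limit_iff_laplace_mean_limit[OF g])
  \<comment> \<open>Agreement for \<open>t > 0\<close> suffices for limits at infinity.\<close>
  moreover have "(laplace_mean ?g \<longlongrightarrow> v) at_top \<longleftrightarrow> (V_occ p \<longlongrightarrow> v) at_top"
    by (intro filterlim_cong refl eventually_mono[OF eventually_gt_at_top[of 0]])
      (simp add: V_occ_eq_laplace_mean[OF assms(2,3)])
  ultimately show ?thesis by (simp add: head_mass_def tail_mass_def D_int_def)
qed

end
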